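(* Let $d\ge2$. For any convex body $\mathcal C\subseteq\tilde{\mathcal K}^d$ with $\operatorname{Vol}(\mathcal C)=1$, $$\inf_{\Lambda\in\mathcal L_d}\operatorname{CovRad}_{\mathcal C}(\Lambda)=\frac1q.$$
   Context: Let $q$ be a prime power, $\mathcal R=\mathbb F_q[x]$, and $\tilde{\mathcal K}=\mathbb F_q((x^{-1}))$, with the absolute value $|\cdot|$ extending $|f|=q^{\deg f}$ for nonzero $f\in\mathcal R$ (and $|0|=0$); $\mathcal O=\mathbb F_q[[x^{-1}]]=\{f\in\tilde{\mathcal K}:|f|\le1\}$. On $\tilde{\mathcal K}^d$ use the norm $\|\mathbf v\|=\max_i|v_i|$. $\mathcal L_d$ is the space of unimodular lattices in $\tilde{\mathcal K}^d$, i.e. sets $g\mathcal R^d$ with $g$ an invertible $d\times d$ matrix over $\tilde{\mathcal K}$ with $|\det(g)|=1$. A convex body is a set $\mathcal C=h\mathcal O^d$ with $h\in\mathrm{GL}_d(\tilde{\mathcal K})$; its volume is $\operatorname{Vol}(\mathcal C)=|\det(h)|$ (its Haar measure, normalized so that $\mathcal O^d$ has measure $1$). For real $r>0$, $r\mathcal C=h\{\mathbf w\in\tilde{\mathcal K}^d:\|\mathbf w\|\le r\}$, and $\operatorname{CovRad}_{\mathcal C}(\Lambda)$ is the smallest $r>0$ such that $\Lambda+r\mathcal C=\tilde{\mathcal K}^d$. *)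

theory Defs
  imports
    "HOL-Analysis.Analysis"
    "HOL-Computational_Algebra.Formal_Laurent_Series"
begin

unbundle no Formal_Power_Series.fps_syntax

text \<open>
  The finite field \<open>F_q\<close> is a type \<open>'a\<close> of classes \<open>finite\<close> and \<open>field\<close>, so that
  \<open>q = CARD('a)\<close>. The field \<open>F_q((1/x))\<close> is the type \<open>'a fls\<close> whose formal variable
  \<open>fls_X\<close> stands for \<open>1/x\<close>; hence \<open>x\<close> itself is \<open>fls_X_inv\<close>. The metric that the library
  puts on \<open>'a fls\<close> uses base 2 instead of \<open>q\<close> and is not used here.
\<close>

definition poly_at_x :: "'a::field poly \<Rightarrow> 'a fls" where
  "poly_at_x f = poly (map_poly fls_const f) fls_X_inv"

definition poly_ring :: "'a::field fls set" where
  "poly_ring = range poly_at_x"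

definition qabs :: "'a::{finite,field} fls \<Rightarrow> real" where
  "qabs f = (if f = 0 then 0 else real CARD('a) powi (- fls_subdegree f))"

definition int_ring :: "'a::{finite,field} fls set" where
  "int_ring = {f. qabs f \<le> 1}"

definition qnorm :: "'a::{finite,field} fls ^ 'd \<Rightarrow> real" where
  "qnorm v = (MAX i. qabs (v $ i))"

definition vecs_over :: "'b set \<Rightarrow> ('b ^ 'd) set" where
  "vecs_over S = {v. \<forall>i. v $ i \<in> S}"

definition unimodular_lattices :: "('a::{finite,field} fls ^ 'd) set set" where
  "unimodular_lattices =
     {(*v) g ` vecs_over poly_ring | g :: 'a fls ^ 'd ^ 'd. invertible g \<and> qabs (det g) = 1}"

definition fconvex_body :: "('a::{finite,field} fls ^ 'd) set \<Rightarrow> bool" where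
  "fconvex_body C \<longleftrightarrow>
     (\<exists>h :: 'a fls ^ 'd ^ 'd. invertible h \<and> C = (*v) h ` vecs_over int_ring)"

text \<open>
  Neither the volume nor the dilate of \<open>C\<close> depends on the matrix \<open>h\<close> chosen to represent \<open>C\<close>;
  see \<open>body_volume_eq\<close> and \<open>body_scale_eq\<close> below.
\<close>

definition body_volume :: "('a::{finite,field} fls ^ 'd) set \<Rightarrow> real" where
  "body_volume C = (THE V. \<exists>h :: 'a fls ^ 'd ^ 'd.
     invertible h \<and> C = (*v) h ` vecs_over int_ring \<and> V = qabs (det h))"

definition body_scale ::
    "real \<Rightarrow> ('a::{finite,field} fls ^ 'd) set \<Rightarrow> ('a fls ^ 'd) set" where
  "body_scale r C = (THE D. \<exists>h :: 'a fls ^ 'd ^ 'd.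
     invertible h \<and> C = (*v) h ` vecs_over int_ring \<and> D = (*v) h ` {w. qnorm w \<le> r})"

definition covers_space ::
    "('a::{finite,field} fls ^ 'd) set \<Rightarrow> ('a fls ^ 'd) set \<Rightarrow> real \<Rightarrow> bool" where
  "covers_space C L r \<longleftrightarrow> {u + v | u v. u \<in> L \<and> v \<in> body_scale r C} = UNIV"

text \<open>The minimum exists for every convex body and unimodular lattice; see \<open>cov_rad_least\<close> below.\<close>

definition cov_rad ::
    "('a::{finite,field} fls ^ 'd) set \<Rightarrow> ('a fls ^ 'd) set \<Rightarrow> real" where
  "cov_rad C L = (LEAST r. r > 0 \<and> covers_space C L r)"


subsection \<open>The absolute value\<close>

lemma card_field_gt_1: "real CARD('a::{finite,field}) > 1"
proof -
  have "card {0, 1 :: 'a} \<le> CARD('a)"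
    by (rule card_mono) auto
  thus ?thesis by simp
qed

lemma qabs_0 [simp]: "qabs 0 = 0"
  by (simp add: qabs_def)

lemma qabs_1 [simp]: "qabs 1 = 1"
  by (simp add: qabs_def)

lemma qabs_nonneg [simp]: "qabs f \<ge> 0"
  by (simp add: qabs_def)

lemma qabs_pos: "f \<noteq> 0 \<Longrightarrow> qabs f > 0"
  by (simp add: qabs_def)

lemma qabs_mult: "qabs (f * g) = qabs f * qabs (g :: 'a::{finite,field} fls)"
  by (simp add: qabs_def power_int_add power_int_diff power_int_minus field_simps)

lemma qabs_le_powi_iff:
  fixes f :: "'a::{finite,field} fls"
  shows "qabs f \<le> real CARD('a) powi m \<longleftrightarrow> f = 0 \<or> - fls_subdegree f \<le> m"
  using card_field_gt_1[where 'a = 'a] power_int_strict_increasing[of m "- fls_subdegree f" "real CARD('a)"]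
    power_int_increasing[of "- fls_subdegree f" m "real CARD('a)"]
  by (auto simp: qabs_def not_le[symmetric])

lemma qabs_add: "qabs (f + g) \<le> max (qabs f) (qabs (g :: 'a::{finite,field} fls))"
proof (cases "f = 0 \<or> g = 0 \<or> f + g = 0")
  case False
  have "fls_subdegree (f + g) \<ge> min (fls_subdegree f) (fls_subdegree g)"
    using False by (intro fls_plus_subdegree) auto
  hence "qabs (f + g) \<le> real CARD('a) powi (- min (fls_subdegree f) (fls_subdegree g))"
    by (subst qabs_le_powi_iff) auto
  thus ?thesis using False by (auto simp: qabs_def min_def split: if_splits)
qed (auto simp: max_def)

lemma qabs_sum_le:
  assumes "\<And>i. i \<in> A \<Longrightarrow> qabs (f i) \<le> r" "r \<ge> 0"
  shows   "qabs (\<Sum>i\<in>A. f i) \<le> r"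
  using assms
proof (induction A rule: infinite_finite_induct)
  case (insert x A)
  thus ?case using qabs_add[of "f x" "\<Sum>i\<in>A. f i"] by fastforce
qed auto

lemma qabs_prod: "qabs (\<Prod>i\<in>A. f i) = (\<Prod>i\<in>A. qabs (f i))"
  by (induction A rule: infinite_finite_induct) (auto simp: qabs_mult)

lemma poly_at_x_nth: "fls_nth (poly_at_x f) n = (if n \<le> 0 then coeff f (nat (- n)) else 0)"
proof -
  have "fls_nth (poly_at_x f) n = (\<Sum>i\<le>degree f. coeff f i * (if n = - int i then 1 else 0))"
    by (simp add: poly_at_x_def poly_altdef fls_nth_sum coeff_map_poly degree_map_poly)
  also have "\<dots> = (\<Sum>i\<le>degree f. if i = nat (- n) \<and> n \<le> 0 then coeff f i else 0)"
    by (intro sum.cong) auto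
  also have "\<dots> = (if n \<le> 0 then coeff f (nat (- n)) else 0)"
    by (auto simp: coeff_eq_0)
  finally show ?thesis .
qed

lemma qabs_poly_at_x:
  fixes f :: "'a::{finite,field} poly"
  assumes "f \<noteq> 0"
  shows   "qabs (poly_at_x f) = real CARD('a) ^ degree f"
proof -
  have 1: "fls_nth (poly_at_x f) (- int (degree f)) \<noteq> 0"
    using assms by (simp add: poly_at_x_nth)
  have "fls_subdegree (poly_at_x f) = - int (degree f)"
    using 1 by (intro fls_subdegree_eqI) (auto simp: poly_at_x_nth coeff_eq_0)
  moreover have "poly_at_x f \<noteq> 0" using 1 by auto
  ultimately show ?thesis by (simp add: qabs_def)
qed

lemma int_ring_eq: "(int_ring :: 'a::{finite,field} fls set) = range fps_to_fls"
proof -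
  have "f \<in> int_ring \<longleftrightarrow> f \<in> range fps_to_fls" for f :: "'a fls"
  proof -
    have "f \<in> int_ring \<longleftrightarrow> f = 0 \<or> fls_subdegree f \<ge> 0"
      using qabs_le_powi_iff[of f 0] by (simp add: int_ring_def)
    also have "\<dots> \<longleftrightarrow> fls_subdegree f \<ge> 0" by auto
    also have "\<dots> \<longleftrightarrow> f \<in> range fps_to_fls"
    proof
      assume "fls_subdegree f \<ge> 0"
      hence "f = fps_to_fls (fls_regpart f)"
        by (intro fls_eqI) auto
      thus "f \<in> range fps_to_fls" by blast
    qed (auto simp: fls_subdegree_fls_to_fps)
    finally show ?thesis .
  qed
  thus ?thesis by blast
qed


subsection \<open>Independence of the representing matrix\<close>

lemma qnorm_le_iff: "qnorm v \<le> r \<longleftrightarrow> (\<forall>i. qabs (v $ i) \<le> r)"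
  for v :: "'a::{finite,field} fls ^ 'd::finite"
  by (auto simp: qnorm_def)

lemma vecs_over_int_ring: "vecs_over int_ring = {w. qnorm w \<le> 1}"
  by (auto simp: vecs_over_def int_ring_def qnorm_le_iff)

lemma int_matrix_entries:
  fixes u :: "'a::{finite,field} fls ^ 'd ^ 'd"
  assumes "(*v) u ` vecs_over int_ring \<subseteq> vecs_over int_ring"
  shows   "qabs (u $ i $ j) \<le> 1"
proof -
  have "axis j 1 \<in> vecs_over (int_ring :: 'a fls set)"
    by (auto simp: vecs_over_def int_ring_def axis_def)
  hence "u *v axis j 1 \<in> vecs_over int_ring" using assms by blast
  moreover have "(u *v axis j 1) $ i = u $ i $ j"
    by (simp add: matrix_vector_mult_def axis_def if_distrib cong: if_cong)
  ultimately show ?thesis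
    by (simp add: vecs_over_def int_ring_def) metis
qed

lemma int_matrix_det:
  fixes u :: "'a::{finite,field} fls ^ 'd ^ 'd"
  assumes "\<And>i j. qabs (u $ i $ j) \<le> 1"
  shows   "qabs (det u) \<le> 1"
  unfolding det_def
proof (rule qabs_sum_le)
  fix p :: "'d \<Rightarrow> 'd"
  have "qabs (of_int (sign p) :: 'a fls) \<le> 1"
    by (auto simp: sign_def qabs_def)
  moreover have "qabs (\<Prod>i\<in>UNIV. u $ i $ p i) \<le> 1"
    unfolding qabs_prod by (rule prod_le_1) (use assms in auto)
  ultimately show "qabs (of_int (sign p) * (\<Prod>i\<in>UNIV. u $ i $ p i)) \<le> 1"
    by (simp add: qabs_mult mult_le_one)
qed auto

lemma int_matrix_ball:
  fixes u :: "'a::{finite,field} fls ^ 'd ^ 'd"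
  assumes "\<And>i j. qabs (u $ i $ j) \<le> 1" "qnorm w \<le> r"
  shows   "qnorm (u *v w) \<le> r"
proof -
  have r: "qabs (w $ j) \<le> r" for j using assms(2) by (simp add: qnorm_le_iff)
  have "r \<ge> 0" using r qabs_nonneg order_trans by blast
  have "qabs ((u *v w) $ i) \<le> r" for i
    unfolding matrix_vector_mult_def vec_lambda_beta
  proof (rule qabs_sum_le)
    fix j
    have "qabs (u $ i $ j) * qabs (w $ j) \<le> 1 * r"
      using assms(1) r \<open>r \<ge> 0\<close> by (intro mult_mono) auto
    thus "qabs (u $ i $ j * w $ j) \<le> r" by (simp add: qabs_mult)
  qed fact
  thus ?thesis by (simp add: qnorm_le_iff)
qed

lemma body_inclusion:
  fixes h k :: "'a::{finite,field} fls ^ 'd ^ 'd"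
  assumes "invertible h" "invertible k"
    and   sub: "(*v) h ` vecs_over int_ring \<subseteq> (*v) k ` vecs_over int_ring"
  shows   "qabs (det h) \<le> qabs (det k)"
    and   "(*v) h ` {w. qnorm w \<le> r} \<subseteq> (*v) k ` {w. qnorm w \<le> r}"
proof -
  obtain k' where k': "k ** k' = mat 1" "k' ** k = mat 1"
    using assms(2) unfolding invertible_def by blast
  define u where "u = k' ** h"
  have h: "h = k ** u"
    by (simp add: u_def matrix_mul_assoc k')
  have "u *v w \<in> vecs_over int_ring" if w: "w \<in> vecs_over int_ring" for w
  proof -
    obtain z where z: "z \<in> vecs_over int_ring" "h *v w = k *v z"
      using subsetD[OF sub imageI[OF w]] by auto
    have "u *v w = k' *v (h *v w)" by (simp add: u_def matrix_vector_mul_assoc)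
    also have "\<dots> = z" by (simp add: z matrix_vector_mul_assoc k')
    finally show ?thesis using z by simp
  qed
  hence u: "qabs (u $ i $ j) \<le> 1" for i j
    by (intro int_matrix_entries image_subsetI)
  have "qabs (det h) = qabs (det k) * qabs (det u)"
    by (simp add: h det_mul qabs_mult)
  also have "\<dots> \<le> qabs (det k) * 1"
    by (intro mult_left_mono int_matrix_det u) auto
  finally show "qabs (det h) \<le> qabs (det k)" by simp
  show "(*v) h ` {w. qnorm w \<le> r} \<subseteq> (*v) k ` {w. qnorm w \<le> r}"
    using int_matrix_ball[OF u] by (auto simp: h simp flip: matrix_vector_mul_assoc)
qed

lemma body_volume_eq:
  fixes h :: "'a::{finite,field} fls ^ 'd ^ 'd"
  assumes "invertible h"
  shows   "body_volume ((*v) h ` vecs_over int_ring) = qabs (det h)"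
  unfolding body_volume_def
proof (rule the_equality)
  fix V
  assume "\<exists>k :: 'a fls ^ 'd ^ 'd. invertible k \<and>
    (*v) h ` vecs_over int_ring = (*v) k ` vecs_over int_ring \<and> V = qabs (det k)"
  then obtain k :: "'a fls ^ 'd ^ 'd" where k: "invertible k"
    "(*v) h ` vecs_over int_ring = (*v) k ` vecs_over int_ring" "V = qabs (det k)" by blast
  show "V = qabs (det h)"
    using body_inclusion(1)[of h k] body_inclusion(1)[of k h] k assms by fastforce
qed (use assms in blast)

lemma body_scale_eq:
  fixes h :: "'a::{finite,field} fls ^ 'd ^ 'd"
  assumes "invertible h"
  shows   "body_scale r ((*v) h ` vecs_over int_ring) = (*v) h ` {w. qnorm w \<le> r}"
  unfolding body_scale_def
proof (rule the_equality)
  fix D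
  assume "\<exists>k :: 'a fls ^ 'd ^ 'd. invertible k \<and>
    (*v) h ` vecs_over int_ring = (*v) k ` vecs_over int_ring \<and> D = (*v) k ` {w. qnorm w \<le> r}"
  then obtain k :: "'a fls ^ 'd ^ 'd" where k: "invertible k"
    "(*v) h ` vecs_over int_ring = (*v) k ` vecs_over int_ring"
    "D = (*v) k ` {w. qnorm w \<le> r}" by blast
  show "D = (*v) h ` {w. qnorm w \<le> r}"
    using body_inclusion(2)[of h k r] body_inclusion(2)[of k h r] k assms by auto
qed (use assms in blast)


subsection \<open>Existence of the covering radius\<close>

text \<open>Absolute values lie in \<open>q^Z\<close>, so a radius may be rounded down to a power of \<open>q\<close>.\<close>

lemma powi_floor:
  fixes r :: real
  assumes "r > 0"
  obtains m :: int where "real CARD('a::{finite,field}) powi m \<le> r"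
    "{w :: 'a fls ^ 'd::finite. qnorm w \<le> r} = {w. qnorm w \<le> real CARD('a) powi m}"
proof -
  let ?q = "real CARD('a)"
  note q = card_field_gt_1[where 'a = 'a]
  define m where "m = \<lfloor>log ?q r\<rfloor>"
  have iff: "?q powi n \<le> r \<longleftrightarrow> n \<le> m" for n
  proof -
    have "?q powi n \<le> r \<longleftrightarrow> ?q powr real_of_int n \<le> r"
      using q by (simp add: powr_real_of_int')
    also have "\<dots> \<longleftrightarrow> real_of_int n \<le> log ?q r"
      using q assms by (simp add: le_log_iff)
    also have "\<dots> \<longleftrightarrow> n \<le> m" by (simp add: m_def le_floor_iff)
    finally show ?thesis .
  qed
  have "qabs f \<le> r \<longleftrightarrow> qabs f \<le> ?q powi m" for f :: "'a fls"
  proof (cases "f = 0")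
    case False
    have "qabs f \<le> r \<longleftrightarrow> - fls_subdegree f \<le> m"
      using iff False by (simp add: qabs_def)
    thus ?thesis using False by (simp add: qabs_le_powi_iff)
  qed (use assms in auto)
  thus ?thesis using that[of m] iff by (auto simp: qnorm_le_iff)
qed

lemma matrix_bound:
  fixes a :: "'a::{finite,field} fls ^ 'd ^ 'd"
  obtains B where "B > 0" "\<And>w. qnorm (a *v w) \<le> B * qnorm w"
proof -
  define B where "B = 1 + (\<Sum>i\<in>UNIV. \<Sum>j\<in>UNIV. qabs (a $ i $ j))"
  have B: "qabs (a $ i $ j) \<le> B" for i j
  proof -
    have "qabs (a $ i $ j) \<le> (\<Sum>j\<in>UNIV. qabs (a $ i $ j))"
      by (rule member_le_sum) auto
    also have "\<dots> \<le> (\<Sum>i\<in>UNIV. \<Sum>j\<in>UNIV. qabs (a $ i $ j))"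
      by (rule member_le_sum[of i UNIV "\<lambda>i. \<Sum>j\<in>UNIV. qabs (a $ i $ j)"])
         (auto intro: sum_nonneg)
    finally show ?thesis by (simp add: B_def)
  qed
  have "B \<ge> 1" by (auto simp: B_def intro!: sum_nonneg)
  have "qnorm (a *v w) \<le> B * qnorm w" for w
  proof -
    have w: "qabs (w $ j) \<le> qnorm w" for j using qnorm_le_iff by blast
    hence "qnorm w \<ge> 0" using qabs_nonneg order_trans by blast
    have "qabs ((a *v w) $ i) \<le> B * qnorm w" for i
      unfolding matrix_vector_mult_def vec_lambda_beta
      by (rule qabs_sum_le) (use B w \<open>B \<ge> 1\<close> \<open>qnorm w \<ge> 0\<close> in \<open>auto simp: qabs_mult intro!: mult_mono\<close>)
    thus ?thesis by (simp add: qnorm_le_iff)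
  qed
  thus ?thesis using that[of B] \<open>B \<ge> 1\<close> by auto
qed

lemma poly_ring_decomp:
  fixes f :: "'a::{finite,field} fls"
  obtains p where "p \<in> poly_ring" "qabs (f - p) \<le> 1"
proof -
  define g where "g = Poly (map (\<lambda>i. fls_nth f (- int i)) [0..<Suc (nat (- fls_subdegree f))])"
  have g: "coeff g i = fls_nth f (- int i)" for i
  proof (cases "i < Suc (nat (- fls_subdegree f))")
    case False
    hence "- int i < fls_subdegree f" by linarith
    thus ?thesis using False by (simp add: g_def coeff_Poly_eq nth_default_def)
  qed (simp add: g_def coeff_Poly_eq nth_default_def del: upt_Suc)
  have "f - poly_at_x g = 0 \<or> fls_subdegree (f - poly_at_x g) \<ge> 0"
    by (auto intro!: fls_subdegree_ge0I simp: poly_at_x_nth g)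
  hence "qabs (f - poly_at_x g) \<le> 1"
    using qabs_le_powi_iff[of "f - poly_at_x g" 0] by simp
  thus ?thesis using that[of "poly_at_x g"] by (simp add: poly_ring_def)
qed

lemma poly_ring_fls_X:
  assumes "p \<in> poly_ring"
  shows   "qabs ((fls_X :: 'a::{finite,field} fls) - p) \<ge> 1 / real CARD('a)"
proof -
  have nz: "fls_nth (fls_X - p) 1 \<noteq> 0"
    using assms by (auto simp: poly_ring_def poly_at_x_nth)
  hence "fls_subdegree (fls_X - p) \<le> 1" by (rule fls_subdegree_leI)
  hence "real CARD('a) powi (-1) \<le> real CARD('a) powi (- fls_subdegree (fls_X - p))"
    using card_field_gt_1[where 'a = 'a] by (intro power_int_increasing) auto
  thus ?thesis using nz by (auto simp: qabs_def power_int_minus field_simps)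
qed

lemma cov_rad_least:
  fixes C :: "('a::{finite,field} fls ^ 'd) set"
  assumes "fconvex_body C" "L \<in> unimodular_lattices"
  shows   "cov_rad C L > 0" "covers_space C L (cov_rad C L)"
    and   "\<And>r. r > 0 \<Longrightarrow> covers_space C L r \<Longrightarrow> cov_rad C L \<le> r"
proof -
  let ?q = "real CARD('a)"
  note q = card_field_gt_1[where 'a = 'a]
  obtain h :: "'a fls ^ 'd ^ 'd" where h: "invertible h" "C = (*v) h ` vecs_over int_ring"
    using assms(1) unfolding fconvex_body_def by blast
  obtain g :: "'a fls ^ 'd ^ 'd" where g: "invertible g" "L = (*v) g ` vecs_over poly_ring"
    using assms(2) unfolding unimodular_lattices_def by blast
  obtain h' where h': "h ** h' = mat 1" "h' ** h = mat 1"
    using h unfolding invertible_def by blast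
  obtain g' where g': "g ** g' = mat 1" "g' ** g = mat 1"
    using g unfolding invertible_def by blast
  have cov: "covers_space C L r \<longleftrightarrow>
      (\<forall>y. \<exists>u\<in>vecs_over poly_ring. \<exists>w. qnorm w \<le> r \<and> y = g *v u + h *v w)" for r
    unfolding covers_space_def h(2) body_scale_eq[OF h(1)] g(2) by (auto simp: set_eq_iff) blast+

  obtain B where B: "B > 0" "\<And>w. qnorm ((h' ** g) *v w) \<le> B * qnorm w"
    using matrix_bound by blast
  have ex: "covers_space C L B"
    unfolding cov
  proof
    fix y :: "'a fls ^ 'd"
    have "\<forall>i. \<exists>p. p \<in> poly_ring \<and> qabs ((g' *v y) $ i - p) \<le> 1"
      using poly_ring_decomp by metis
    then obtain p where p: "\<And>i. p i \<in> poly_ring" "\<And>i. qabs ((g' *v y) $ i - p i) \<le> 1"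
      by metis
    define u where "u = (\<chi> i. p i)"
    have "qnorm (g' *v y - u) \<le> 1" by (simp add: qnorm_le_iff u_def p)
    hence "B * qnorm (g' *v y - u) \<le> B" using B(1) by simp
    hence "qnorm ((h' ** g) *v (g' *v y - u)) \<le> B" using B(2) order_trans by blast
    moreover have "h *v ((h' ** g) *v (g' *v y - u)) = g *v (g' *v y - u)"
      by (simp add: matrix_vector_mul_assoc matrix_mul_assoc h')
    hence "y = g *v u + h *v ((h' ** g) *v (g' *v y - u))"
      by (simp add: matrix_vector_mult_diff_distrib matrix_vector_mul_assoc g')
    moreover have "u \<in> vecs_over poly_ring" by (simp add: u_def vecs_over_def p)
    ultimately show "\<exists>u\<in>vecs_over poly_ring. \<exists>w. qnorm w \<le> B \<and> y = g *v u + h *v w"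
      by blast
  qed

  obtain A where A: "A > 0" "\<And>w. qnorm ((g' ** h) *v w) \<le> A * qnorm w"
    using matrix_bound by blast
  have low: "r \<ge> 1 / (?q * A)" if cv: "covers_space C L r" for r
  proof -
    define z :: "'a fls ^ 'd" where "z = (\<chi> i. fls_X)"
    obtain u w where uw: "u \<in> vecs_over poly_ring" "qnorm w \<le> r" "g *v z = g *v u + h *v w"
      using cv unfolding cov by blast
    have "g' *v (g *v z) = g' *v (g *v u) + g' *v (h *v w)"
      by (simp add: uw matrix_vector_right_distrib)
    hence z: "z - u = (g' ** h) *v w"
      by (simp add: matrix_vector_mul_assoc g')
    have "1 / ?q \<le> qabs ((z - u) $ undefined)"
      using uw by (auto simp: z_def vecs_over_def intro!: poly_ring_fls_X)
    also have "\<dots> \<le> qnorm (z - u)" using qnorm_le_iff by blast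
    also have "\<dots> \<le> A * qnorm w" unfolding z by (rule A)
    also have "\<dots> \<le> A * r" using A(1) uw by simp
    finally show ?thesis using A(1) q by (simp add: field_simps)
  qed

  have down: "\<exists>m. ?q powi m \<le> r \<and> covers_space C L (?q powi m)"
    if r: "r > 0" "covers_space C L r" for r
  proof -
    obtain m where m: "?q powi m \<le> r"
      "{w :: 'a fls ^ 'd. qnorm w \<le> r} = {w. qnorm w \<le> ?q powi m}"
      using powi_floor[OF r(1)] by blast
    hence "qnorm w \<le> r \<longleftrightarrow> qnorm w \<le> ?q powi m" for w :: "'a fls ^ 'd"
      by blast
    thus ?thesis using r(2) m(1) unfolding cov by auto
  qed
  define M where "M = {m. covers_space C L (?q powi m)}"
  obtain m0 where m0: "m0 \<in> M" using down[OF B(1) ex] by (auto simp: M_def)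
  define b where "b = \<lfloor>log ?q (1 / (?q * A))\<rfloor>"
  have b: "b \<le> m" if "m \<in> M" for m
  proof -
    have "1 / (?q * A) \<le> ?q powr real_of_int m"
      using low that q by (auto simp: M_def powr_real_of_int')
    hence "log ?q (1 / (?q * A)) \<le> real_of_int m"
      using q A(1) by (subst log_le_iff) auto
    thus ?thesis unfolding b_def by linarith
  qed
  define k where "k = (LEAST k. b + int k \<in> M)"
  have k: "b + int k \<in> M"
    unfolding k_def by (rule LeastI[of _ "nat (m0 - b)"]) (use m0 b[OF m0] in auto)
  have k_le: "b + int k \<le> m" if "m \<in> M" for m
  proof -
    have "k \<le> nat (m - b)"
      unfolding k_def by (rule Least_le) (use that b[OF that] in auto)
    thus ?thesis using b[OF that] by linarith
  qed
  have le: "?q powi (b + int k) \<le> r" if r: "r > 0" "covers_space C L r" for r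
  proof -
    obtain m where m: "?q powi m \<le> r" "m \<in> M"
      using down[OF r] by (auto simp: M_def)
    have "?q powi (b + int k) \<le> ?q powi m"
      using k_le[OF m(2)] q by (intro power_int_increasing) auto
    thus ?thesis using m(1) by linarith
  qed
  have eq: "cov_rad C L = ?q powi (b + int k)"
    unfolding cov_rad_def
    by (rule Least_equality) (use k le q in \<open>auto simp: M_def\<close>)
  show "cov_rad C L > 0" "covers_space C L (cov_rad C L)"
    using k q by (auto simp: eq M_def)
  show "cov_rad C L \<le> r" if "r > 0" "covers_space C L r" for r
    using le[OF that] by (simp add: eq)
qed

lemma unimodular_lattices_nonempty:
  "(unimodular_lattices :: ('a::{finite,field} fls ^ 'd) set set) \<noteq> {}"
proof -
  have "invertible (mat 1 :: 'a fls ^ 'd ^ 'd)"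
    unfolding invertible_def by (rule exI[of _ "mat 1"]) simp
  hence "(*v) (mat 1 :: 'a fls ^ 'd ^ 'd) ` vecs_over poly_ring \<in> unimodular_lattices"
    by (auto simp: unimodular_lattices_def intro!: exI[of _ "mat 1"])
  thus ?thesis by blast
qed

end

theory Submission
  imports Defs
begin

text \<open>
  Write \<open>C = h O^d\<close> with \<open>|det h| = 1\<close>.

  The value \<open>1/q\<close> is attained by the lattice \<open>h R^d\<close>: after multiplication by the inverse of \<open>h\<close>
  this says that \<open>R^d\<close> and the ball of radius \<open>1/q\<close> together span the space, which holds because
  removing from a Laurent series in \<open>1/x\<close> its polynomial part leaves only positive powers of \<open>1/x\<close>
  (\<open>poly_part_remainder\<close>).

  No lattice \<open>g R^d\<close> does better. Suppose that it covers with a radius \<open>r < 1/q\<close>. Approximating each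
  vector \<open>x\<^sup>-\<^sup>1 h e\<^sub>j\<close> by a lattice vector gives \<open>d\<close> lattice vectors; arranged as columns they read
  \<open>g V = h (x\<^sup>-\<^sup>1 I - W)\<close> with \<open>V\<close> a matrix of polynomials and all entries of \<open>W\<close> of absolute value at
  most \<open>r\<close>. The matrix \<open>x\<^sup>-\<^sup>1 I - W\<close> is nonsingular because its diagonal dominates
  (\<open>det_scalar_minus_small_nonzero\<close>), and its determinant has absolute value below \<open>1\<close> because its
  entries do. As \<open>g\<close> and \<open>h\<close> have determinants of absolute value \<open>1\<close>, it follows that
  \<open>0 < |det V| < 1\<close>. But \<open>det V\<close> is a polynomial, and a nonzero polynomial has absolute value at
  least \<open>1\<close>. This determinant comparison takes the place of a comparison of volumes.
\<close>

section \<open>Polynomials inside the Laurent series\<close>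

lemma poly_at_x_0: "poly_at_x 0 = 0"
  by (simp add: poly_at_x_def)

lemma poly_at_x_1: "poly_at_x 1 = 1"
  by (simp add: poly_at_x_def)

lemma poly_at_x_add: "poly_at_x (f + g) = poly_at_x f + poly_at_x g"
  by (rule fls_eqI) (simp add: poly_at_x_nth)

lemma poly_at_x_uminus: "poly_at_x (- f) = - poly_at_x f"
  by (rule fls_eqI) (simp add: poly_at_x_nth)

lemma poly_at_x_smult: "poly_at_x (smult a f) = fls_const a * poly_at_x f"
  by (rule fls_eqI) (simp add: poly_at_x_nth)

lemma poly_at_x_pCons: "poly_at_x (pCons a f) = fls_const a + fls_X_inv * poly_at_x f"
  by (simp add: poly_at_x_def map_poly_pCons)

lemma poly_at_x_mult: "poly_at_x (f * g) = poly_at_x f * poly_at_x g"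
proof (induction f)
  case 0
  show ?case by (simp add: poly_at_x_0)
next
  case (pCons a f)
  thus ?case
    by (simp add: poly_at_x_add poly_at_x_smult poly_at_x_pCons algebra_simps)
qed

lemma poly_ring_0: "0 \<in> poly_ring"
  unfolding poly_ring_def using poly_at_x_0 by (metis rangeI)

lemma poly_ring_1: "1 \<in> poly_ring"
  unfolding poly_ring_def using poly_at_x_1 by (metis rangeI)

lemma poly_ring_add: "f \<in> poly_ring \<Longrightarrow> g \<in> poly_ring \<Longrightarrow> f + g \<in> poly_ring"
  unfolding poly_ring_def by (auto simp flip: poly_at_x_add)

lemma poly_ring_uminus: "f \<in> poly_ring \<Longrightarrow> - f \<in> poly_ring"
  unfolding poly_ring_def by (auto simp flip: poly_at_x_uminus)

lemma poly_ring_mult: "f \<in> poly_ring \<Longrightarrow> g \<in> poly_ring \<Longrightarrow> f * g \<in> poly_ring"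
  unfolding poly_ring_def by (auto simp flip: poly_at_x_mult)

lemma poly_ring_sum: "(\<And>i. i \<in> A \<Longrightarrow> f i \<in> poly_ring) \<Longrightarrow> (\<Sum>i\<in>A. f i) \<in> poly_ring"
  by (induction A rule: infinite_finite_induct) (auto intro: poly_ring_0 poly_ring_add)

lemma poly_ring_prod: "(\<And>i. i \<in> A \<Longrightarrow> f i \<in> poly_ring) \<Longrightarrow> (\<Prod>i\<in>A. f i) \<in> poly_ring"
  by (induction A rule: infinite_finite_induct) (auto intro: poly_ring_1 poly_ring_mult)

lemma poly_ring_det:
  fixes V :: "'a::field fls ^ 'd::finite ^ 'd"
  assumes "\<And>i j. V $ i $ j \<in> poly_ring"
  shows   "det V \<in> poly_ring"
  unfolding det_def using assms
  by (auto simp: sign_def intro!: poly_ring_sum poly_ring_mult poly_ring_prod poly_ring_1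
        poly_ring_uminus)

lemma qabs_poly_ring_ge_1:
  fixes f :: "'a::{finite,field} fls"
  assumes "f \<in> poly_ring" "f \<noteq> 0"
  shows   "qabs f \<ge> 1"
proof -
  obtain p where p: "f = poly_at_x p" using assms(1) by (auto simp: poly_ring_def)
  with assms(2) have "p \<noteq> 0" by (auto simp: poly_at_x_0)
  thus ?thesis
    using card_field_gt_1[where 'a = 'a] by (simp add: p qabs_poly_at_x)
qed

text \<open>
  The coefficients of \<open>x\<^sup>0, x\<^sup>1, \<dots>\<close> form a polynomial, and what remains starts at \<open>x\<^sup>-\<^sup>1\<close>. Compared with
  \<open>poly_ring_decomp\<close> the constant coefficient is also removed, which gains the factor \<open>1/q\<close>.
\<close>

lemma poly_part_remainder:
  fixes f :: "'a::{finite,field} fls"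
  obtains p where "p \<in> poly_ring" "qabs (f - p) \<le> 1 / real CARD('a)"
proof -
  obtain p0 where p0: "p0 \<in> poly_ring" "qabs (f - p0) \<le> 1"
    using poly_ring_decomp by blast
  define c where "c = poly_at_x [:fls_nth (f - p0) 0:]"
  have c: "c \<in> poly_ring" by (simp add: c_def poly_ring_def)
  have low: "fls_nth (f - p0) n = 0" if "n < 0" for n
    using p0(2) qabs_le_powi_iff[of "f - p0" 0] that
      fls_eq0_below_subdegree[of n "f - p0"] by fastforce
  have "fls_nth (f - p0 - c) n = 0" if "n < 1" for n
    using low[of n] that by (cases "n = 0") (auto simp: c_def poly_at_x_nth coeff_pCons split: nat.splits)
  hence "f - p0 - c = 0 \<or> fls_subdegree (f - p0 - c) \<ge> 1"
    by (metis fls_subdegree_geI)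
  hence "qabs (f - p0 - c) \<le> real CARD('a) powi (- 1)"
    by (subst qabs_le_powi_iff) auto
  hence "qabs (f - (p0 + c)) \<le> 1 / real CARD('a)"
    by (simp add: power_int_minus field_simps)
  thus ?thesis using that poly_ring_add[OF p0(1) c] by blast
qed

section \<open>Determinants and the absolute value\<close>

lemma qabs_det_less_1:
  fixes A :: "'a::{finite,field} fls ^ 'd::finite ^ 'd"
  assumes "\<And>i j. qabs (A $ i $ j) \<le> t" "t < 1"
  shows   "qabs (det A) < 1"
proof -
  have t: "t \<ge> 0" using assms(1) qabs_nonneg order_trans by blast
  have "qabs (det A) \<le> t ^ CARD('d)"
    unfolding det_def
  proof (rule qabs_sum_le)
    fix p :: "'d \<Rightarrow> 'd"
    have "qabs (of_int (sign p) :: 'a fls) \<le> 1"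
      by (auto simp: sign_def qabs_def)
    moreover have "qabs (\<Prod>i\<in>UNIV. A $ i $ p i) \<le> (\<Prod>i\<in>(UNIV :: 'd set). t)"
      unfolding qabs_prod by (rule prod_mono) (use assms in auto)
    ultimately have "qabs (of_int (sign p) :: 'a fls) * qabs (\<Prod>i\<in>UNIV. A $ i $ p i)
        \<le> 1 * t ^ CARD('d)"
      by (intro mult_mono) auto
    thus "qabs (of_int (sign p) * (\<Prod>i\<in>UNIV. A $ i $ p i)) \<le> t ^ CARD('d)"
      by (simp add: qabs_mult)
  qed (use t in auto)
  also have "\<dots> < 1"
    using t assms(2) by (intro power_less_one_iff[THEN iffD2]) auto
  finally show ?thesis .
qed

text \<open>
  A kernel vector \<open>z\<close> satisfies \<open>c z = W z\<close>. At a coordinate where \<open>|z\<^sub>i|\<close> is largest, the left side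
  has absolute value \<open>|c| |z\<^sub>i|\<close> and, by the ultrametric inequality, the right side at most \<open>r |z\<^sub>i|\<close>.
\<close>

lemma det_scalar_minus_small_nonzero:
  fixes W :: "'a::{finite,field} fls ^ 'd::finite ^ 'd"
  assumes "\<And>i j. qabs (W $ i $ j) \<le> r" "r < qabs c"
  shows   "det (mat c - W) \<noteq> 0"
proof -
  have r: "r \<ge> 0" using assms(1) qabs_nonneg order_trans by blast
  have "z = 0" if z: "(mat c - W) *v z = 0" for z
  proof (rule ccontr)
    assume "z \<noteq> 0"
    then obtain k where k: "z $ k \<noteq> 0" by (auto simp: vec_eq_iff)
    obtain i where i: "\<And>j. qabs (z $ j) \<le> qabs (z $ i)"
    proof -
      have "qnorm z \<in> range (\<lambda>i. qabs (z $ i))"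
        unfolding qnorm_def by (rule Max_in) auto
      then obtain i where "qnorm z = qabs (z $ i)" by blast
      thus ?thesis using that[of i] qnorm_le_iff[of z "qnorm z"] by auto
    qed
    have pos: "qabs (z $ i) > 0" using qabs_pos[OF k] i[of k] by linarith
    have "mat c *v z = W *v z"
      using z by (simp add: matrix_vector_mult_diff_rdistrib)
    moreover have "(mat c *v z) $ i = c * z $ i"
      by (simp add: matrix_vector_mult_def mat_def if_distrib[of "\<lambda>a. a * _"] cong: if_cong)
    ultimately have eq: "c * z $ i = (\<Sum>j\<in>UNIV. W $ i $ j * z $ j)"
      by (simp add: matrix_vector_mult_def)
    have "qabs (c * z $ i) \<le> r * qabs (z $ i)"
      unfolding eq
      by (rule qabs_sum_le) (use assms(1) i r in \<open>auto simp: qabs_mult intro!: mult_mono\<close>)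
    thus False using assms(2) pos by (simp add: qabs_mult)
  qed
  hence "invertible (mat c - W)"
    by (simp add: invertible_left_inverse matrix_left_invertible_ker)
  thus ?thesis by (simp add: invertible_det_nz)
qed

section \<open>Covering radii\<close>

lemma covers_space_matrix_iff:
  fixes g h :: "'a::{finite,field} fls ^ 'd::finite ^ 'd"
  assumes "invertible h"
  shows   "covers_space ((*v) h ` vecs_over int_ring) ((*v) g ` vecs_over poly_ring) r \<longleftrightarrow>
      (\<forall>y. \<exists>u\<in>vecs_over poly_ring. \<exists>w. qnorm w \<le> r \<and> y = g *v u + h *v w)"
  unfolding covers_space_def body_scale_eq[OF assms] by (auto simp: set_eq_iff) blast+

text \<open>
  The lattice vectors that approximate \<open>x\<^sup>-\<^sup>1 h e\<^sub>j\<close> with an error smaller than \<open>x\<^sup>-\<^sup>1\<close> are independent,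
  so they span a sublattice, whose covolume is at least that of the lattice; but they all lie in
  \<open>h (x\<^sup>-\<^sup>1 O)^d\<close>, which leaves room only for a smaller covolume.
\<close>

lemma covering_radius_ge:
  fixes g h :: "'a::{finite,field} fls ^ 'd::finite ^ 'd"
  assumes h: "invertible h" and dets: "qabs (det g) = qabs (det h)"
    and cov: "covers_space ((*v) h ` vecs_over int_ring) ((*v) g ` vecs_over poly_ring) r"
  shows   "r \<ge> 1 / real CARD('a)"
proof (rule ccontr)
  assume "\<not> r \<ge> 1 / real CARD('a)"
  hence r: "r < 1 / real CARD('a)" by simp
  have X: "qabs (fls_X :: 'a fls) = 1 / real CARD('a)"
    by (simp add: qabs_def power_int_minus field_simps)
  have "\<forall>j. \<exists>u w. u \<in> vecs_over poly_ring \<and> qnorm w \<le> r \<and>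
      h *v axis j fls_X = g *v u + h *v w"
    using cov unfolding covers_space_matrix_iff[OF h] by blast
  then obtain v w where vw: "\<And>j. v j \<in> vecs_over poly_ring" "\<And>j. qnorm (w j) \<le> r"
    "\<And>j. h *v axis j fls_X = g *v v j + h *v w j"
    by metis
  define V :: "'a fls ^ 'd ^ 'd" where "V = (\<chi> i j. v j $ i)"
  define W :: "'a fls ^ 'd ^ 'd" where "W = (\<chi> i j. w j $ i)"
  let ?M = "mat fls_X - W :: 'a fls ^ 'd ^ 'd"
  have W: "qabs (W $ i $ j) \<le> r" for i j
    using vw(2)[of j] by (simp add: W_def qnorm_le_iff)
  have V: "det V \<in> poly_ring"
    by (rule poly_ring_det) (use vw(1) in \<open>auto simp: V_def vecs_over_def\<close>)

  have "g ** V = h ** ?M"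
  proof -
    have "(g ** V) $ i $ j = (h ** ?M) $ i $ j" for i j
    proof -
      have "(g ** V) $ i $ j = (g *v v j) $ i"
        by (simp add: matrix_matrix_mult_def matrix_vector_mult_def V_def)
      also have "g *v v j = h *v (axis j fls_X - w j)"
        using vw(3)[of j] by (simp add: matrix_vector_mult_diff_distrib)
      also have "axis j fls_X - w j = (\<chi> k. ?M $ k $ j)"
        by (auto simp: vec_eq_iff axis_def mat_def W_def)
      finally show ?thesis
        by (simp add: matrix_matrix_mult_def matrix_vector_mult_def)
    qed
    thus ?thesis by (simp add: vec_eq_iff)
  qed
  hence eq: "det g * det V = det h * det ?M"
    by (metis det_mul)
  have det_h: "det h \<noteq> 0" using h by (simp add: invertible_det_nz)

  have "det ?M \<noteq> 0"
    by (rule det_scalar_minus_small_nonzero[OF W]) (use r X in simp)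
  hence "det V \<noteq> 0" using eq det_h by auto
  hence "qabs (det V) \<ge> 1" using V by (rule qabs_poly_ring_ge_1[rotated])
  moreover have "qabs (det V) = qabs (det ?M)"
  proof -
    have "qabs (det h) * qabs (det V) = qabs (det h) * qabs (det ?M)"
      using arg_cong[OF eq, of qabs] dets by (simp add: qabs_mult)
    thus ?thesis using qabs_pos[OF det_h] by simp
  qed
  moreover have "qabs (det ?M) < 1"
  proof (rule qabs_det_less_1)
    show "1 / real CARD('a) < 1" using card_field_gt_1[where 'a = 'a] by simp
    show "qabs (?M $ i $ j) \<le> 1 / real CARD('a)" for i j
    proof -
      let ?X = "mat fls_X :: 'a fls ^ 'd ^ 'd"
      have "qabs (?X $ i $ j + - (W $ i $ j)) \<le> max (qabs (?X $ i $ j)) (qabs (- (W $ i $ j)))"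
        by (rule qabs_add)
      moreover have "qabs (- (W $ i $ j)) = qabs (W $ i $ j)"
        by (simp add: qabs_def)
      moreover have "qabs (?X $ i $ j) \<le> 1 / real CARD('a)"
        using X by (auto simp: mat_def)
      ultimately show ?thesis using W[of i j] r by simp
    qed
  qed
  ultimately show False by simp
qed

lemma covers_space_own_lattice:
  fixes h :: "'a::{finite,field} fls ^ 'd::finite ^ 'd"
  assumes h: "invertible h"
  shows   "covers_space ((*v) h ` vecs_over int_ring) ((*v) h ` vecs_over poly_ring)
             (1 / real CARD('a))"
  unfolding covers_space_matrix_iff[OF h]
proof
  fix y :: "'a fls ^ 'd"
  obtain h' where h': "h ** h' = mat 1" using h unfolding invertible_def by blast
  have "\<forall>i. \<exists>p. p \<in> poly_ring \<and> qabs ((h' *v y) $ i - p) \<le> 1 / real CARD('a)"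
    using poly_part_remainder by metis
  then obtain p where p: "\<And>i. p i \<in> poly_ring"
    "\<And>i. qabs ((h' *v y) $ i - p i) \<le> 1 / real CARD('a)"
    by metis
  define u where "u = (\<chi> i. p i)"
  have "u \<in> vecs_over poly_ring" by (simp add: u_def vecs_over_def p)
  moreover have "qnorm (h' *v y - u) \<le> 1 / real CARD('a)"
    by (simp add: qnorm_le_iff u_def p)
  moreover have "y = h *v u + h *v (h' *v y - u)"
    by (simp add: matrix_vector_mult_diff_distrib matrix_vector_mul_assoc h')
  ultimately show "\<exists>u\<in>vecs_over poly_ring. \<exists>w. qnorm w \<le> 1 / real CARD('a) \<and> y = h *v u + h *v w"
    by blast
qed

theorem theorem1p27:
  fixes C :: "('a::{finite,field} fls ^ 'd::finite) set"
  assumes "CARD('d) \<ge> 2"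
    and "fconvex_body C"
    and "body_volume C = 1"
  shows "(INF L \<in> unimodular_lattices. cov_rad C L) = 1 / real CARD('a)"
proof -
  obtain h :: "'a fls ^ 'd ^ 'd" where h: "invertible h" "C = (*v) h ` vecs_over int_ring"
    using assms(2) unfolding fconvex_body_def by blast
  have det_h: "qabs (det h) = 1"
    using assms(3) body_volume_eq[OF h(1)] h(2) by simp
  define L0 where "L0 = (*v) h ` vecs_over poly_ring"
  have L0: "L0 \<in> unimodular_lattices"
    using h(1) det_h by (auto simp: L0_def unimodular_lattices_def)
  have lower: "1 / real CARD('a) \<le> cov_rad C L" if L: "L \<in> unimodular_lattices" for L
  proof -
    obtain g :: "'a fls ^ 'd ^ 'd" where g: "qabs (det g) = 1" "L = (*v) g ` vecs_over poly_ring"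
      using L unfolding unimodular_lattices_def by blast
    show ?thesis
      using covering_radius_ge[OF h(1), of g] g det_h cov_rad_least(2)[OF assms(2) L] h(2) by simp
  qed
  have upper: "cov_rad C L0 \<le> 1 / real CARD('a)"
    using covers_space_own_lattice[OF h(1)] card_field_gt_1[where 'a = 'a]
    by (intro cov_rad_least(3)[OF assms(2) L0]) (auto simp: L0_def h(2))
  show ?thesis
  proof (rule antisym)
    have "bdd_below (cov_rad C ` unimodular_lattices)"
      using lower by (intro bdd_belowI2)
    thus "(INF L \<in> unimodular_lattices. cov_rad C L) \<le> 1 / real CARD('a)"
      using L0 upper by (rule cINF_lower2)
    show "1 / real CARD('a) \<le> (INF L \<in> unimodular_lattices. cov_rad C L)"
      using unimodular_lattices_nonempty lower by (rule cINF_greatest)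
  qed
qed

end
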